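(* Let $G$ be a cograph. Then $G$ is well-equi-hued if and only if its complement $\overline{G}$ is well-equi-hued.
   Context: All graphs are finite and simple. For $k\ge 1$, a maximal $k$-colorable subgraph of $G$ is a subgraph induced by a set $S\subseteq V(G)$ such that $G[S]$ is (properly) $k$-colorable and $G[S']$ is not $k$-colorable for every $S'$ with $S\subsetneq S'\subseteq V(G)$. $G$ is well-hued if for every $k\ge 1$ all maximal $k$-colorable subgraphs of $G$ have the same order, denoted $a_k$. A graph $G$ of order $n$ with chromatic number $\chi$ is well-equi-hued if it is well-hued and $a_i=\frac{i}{\chi}n$ for all $i\in\{1,\dots,\chi\}$. Cographs are the smallest class of graphs containing the one-vertex graph $K_1$ and closed under disjoint unions and joins (the join $G\vee H$ is the disjoint union of $G$ and $H$ together with all edges between $V(G)$ and $V(H)$). *)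

theory Defs
  imports Complex_Main
begin

record 'a graph =
  verts :: "'a set"
  edges :: "'a set set"

definition simple_graph :: "'a graph \<Rightarrow> bool" where
  "simple_graph G \<longleftrightarrow> finite (verts G) \<and> (\<forall>e\<in>edges G. e \<subseteq> verts G \<and> card e = 2)"

definition complement :: "'a graph \<Rightarrow> 'a graph" where
  "complement G = \<lparr>verts = verts G,
     edges = {e. e \<subseteq> verts G \<and> card e = 2 \<and> e \<notin> edges G}\<rparr>"

definition induced_subgraph :: "'a graph \<Rightarrow> 'a set \<Rightarrow> 'a graph" where
  "induced_subgraph G S = \<lparr>verts = S, edges = {e \<in> edges G. e \<subseteq> S}\<rparr>"

definition k_colorable :: "nat \<Rightarrow> 'a graph \<Rightarrow> bool" where
  "k_colorable k G \<longleftrightarrow>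
     (\<exists>c :: 'a \<Rightarrow> nat. c ` verts G \<subseteq> {..<k} \<and> (\<forall>u v. {u, v} \<in> edges G \<longrightarrow> c u \<noteq> c v))"

definition chromatic_number :: "'a graph \<Rightarrow> nat" where
  "chromatic_number G = (LEAST k. k_colorable k G)"

definition maximal_k_colorable :: "nat \<Rightarrow> 'a graph \<Rightarrow> 'a set \<Rightarrow> bool" where
  "maximal_k_colorable k G S \<longleftrightarrow>
     S \<subseteq> verts G \<and> k_colorable k (induced_subgraph G S) \<and>
     (\<forall>S'. S \<subset> S' \<and> S' \<subseteq> verts G \<longrightarrow> \<not> k_colorable k (induced_subgraph G S'))"

definition well_hued :: "'a graph \<Rightarrow> bool" where
  "well_hued G \<longleftrightarrow>
     (\<forall>k\<ge>1. \<forall>S T. maximal_k_colorable k G S \<longrightarrow> maximal_k_colorable k G T \<longrightarrow> card S = card T)"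

text \<open>The number \<open>a\<^sub>k\<close>. It is meaningful only for well-hued graphs, where the common order of the
  maximal \<open>k\<close>-colorable subgraphs exists (finiteness yields at least one) and is unique.\<close>
definition hued_order :: "'a graph \<Rightarrow> nat \<Rightarrow> nat" where
  "hued_order G k = (THE m. \<exists>S. maximal_k_colorable k G S \<and> card S = m)"

definition well_equi_hued :: "'a graph \<Rightarrow> bool" where
  "well_equi_hued G \<longleftrightarrow> well_hued G \<and>
     (\<forall>i\<in>{1..chromatic_number G}.
        real (hued_order G i) = real i / real (chromatic_number G) * real (card (verts G)))"

definition graph_union :: "'a graph \<Rightarrow> 'a graph \<Rightarrow> 'a graph" where
  "graph_union G H = \<lparr>verts = verts G \<union> verts H, edges = edges G \<union> edges H\<rparr>"

definition graph_join :: "'a graph \<Rightarrow> 'a graph \<Rightarrow> 'a graph" where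
  "graph_join G H = \<lparr>verts = verts G \<union> verts H,
     edges = edges G \<union> edges H \<union> {{u, v} |u v. u \<in> verts G \<and> v \<in> verts H}\<rparr>"

text \<open>Unions and joins are formed only of graphs on disjoint vertex sets. No closure under
  isomorphism has to be added: every one-vertex graph over \<open>'a\<close> is a base case, and a cograph
  decomposes into cographs on parts of its own vertex set.\<close>
inductive cograph :: "'a graph \<Rightarrow> bool" where
  single: "cograph \<lparr>verts = {v}, edges = {}\<rparr>"
| union: "cograph G \<Longrightarrow> cograph H \<Longrightarrow> verts G \<inter> verts H = {} \<Longrightarrow> cograph (graph_union G H)"
| join: "cograph G \<Longrightarrow> cograph H \<Longrightarrow> verts G \<inter> verts H = {} \<Longrightarrow> cograph (graph_join G H)"

lemma cograph_simple_graph: "cograph G \<Longrightarrow> simple_graph G"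
proof (induction rule: cograph.induct)
  case (single v)
  show ?case by (simp add: simple_graph_def)
next
  case (union G H)
  then show ?case by (auto simp: simple_graph_def graph_union_def)
next
  case (join G H)
  have "card {u, v} = 2" if "u \<in> verts G" "v \<in> verts H" for u v
    using join.hyps that by (metis card_2_iff disjoint_iff)
  with join.IH show ?case by (auto simp: simple_graph_def graph_join_def)
qed

end

theory Submission imports Defs begin

text \<open>Call \<open>G\<close> balanced with parameters \<open>(x, m)\<close> if \<open>\<chi>(G) = x\<close> and all maximal
  \<open>k\<close>-colorable subgraphs have order \<open>k m\<close> for \<open>k \<le> x\<close>; a nonempty graph is well-equi-hued iff it is
  balanced for some \<open>m\<close>. A disjoint union is balanced with \<open>(x, m)\<close> iff its parts are balanced
  with \<open>(x, m\<^sub>1)\<close> and \<open>(x, m\<^sub>2)\<close> for some \<open>m\<^sub>1 + m\<^sub>2 = m\<close>, and a join is balanced with \<open>(x, m)\<close> iff its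
  parts are balanced with \<open>(x\<^sub>1, m)\<close> and \<open>(x\<^sub>2, m)\<close> for some \<open>x\<^sub>1 + x\<^sub>2 = x\<close>. Complementation exchanges
  unions and joins, so it exchanges the two parameters.\<close>

section \<open>Colorability of vertex subsets and the chromatic number\<close>

text \<open>Colorings are attached to a vertex set of a fixed graph, so that subsets can be
  enlarged, shrunk and split without building induced subgraphs.\<close>

definition colorable_on :: "nat \<Rightarrow> 'a graph \<Rightarrow> 'a set \<Rightarrow> bool" where
  "colorable_on k G S \<longleftrightarrow>
     (\<exists>c :: 'a \<Rightarrow> nat. c ` S \<subseteq> {..<k} \<and> (\<forall>u\<in>S. \<forall>v\<in>S. {u, v} \<in> edges G \<longrightarrow> c u \<noteq> c v))"

lemma k_colorable_induced_subgraph: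
  "k_colorable k (induced_subgraph G S) \<longleftrightarrow> colorable_on k G S"
proof -
  have "(\<forall>u v. {u, v} \<in> edges G \<and> {u, v} \<subseteq> S \<longrightarrow> c u \<noteq> c v) \<longleftrightarrow>
    (\<forall>u\<in>S. \<forall>v\<in>S. {u, v} \<in> edges G \<longrightarrow> c u \<noteq> c v)" for c :: "'a \<Rightarrow> nat"
    by auto
  then show ?thesis by (simp add: k_colorable_def induced_subgraph_def colorable_on_def)
qed

lemma k_colorable_iff:
  assumes "simple_graph G"
  shows "k_colorable k G \<longleftrightarrow> colorable_on k G (verts G)"
proof -
  have "e \<subseteq> verts G" if "e \<in> edges G" for e
    using assms that by (simp add: simple_graph_def)
  then have "induced_subgraph G (verts G) = G" by (cases G) (auto simp: induced_subgraph_def)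
  then show ?thesis by (metis k_colorable_induced_subgraph)
qed

lemma maximal_k_colorable_iff:
  "maximal_k_colorable k G S \<longleftrightarrow> S \<subseteq> verts G \<and> colorable_on k G S \<and>
     (\<forall>T. S \<subseteq> T \<longrightarrow> T \<subseteq> verts G \<longrightarrow> colorable_on k G T \<longrightarrow> T = S)"
  by (auto simp: maximal_k_colorable_def k_colorable_induced_subgraph)

lemma maximal_k_colorableD:
  assumes "maximal_k_colorable k G S" "S \<subseteq> T" "T \<subseteq> verts G" "colorable_on k G T"
  shows "T = S"
  using assms by (simp add: maximal_k_colorable_iff)

lemma colorable_on_mono:
  assumes "colorable_on k G S" "k \<le> l" "T \<subseteq> S"
  shows "colorable_on l G T"
proof -
  obtain c where c: "c ` S \<subseteq> {..<k}" "\<forall>u\<in>S. \<forall>v\<in>S. {u, v} \<in> edges G \<longrightarrow> c u \<noteq> c v"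
    using assms(1) by (auto simp: colorable_on_def)
  have "c ` T \<subseteq> {..<l}" using c(1) assms(2,3) by fastforce
  then show ?thesis using c(2) assms(3) unfolding colorable_on_def by blast
qed

text \<open>The colors in use may come from any type and have gaps: a bijection from the image of
  \<open>c\<close> onto an initial segment of the naturals renumbers them.\<close>

lemma colorable_on_card_image:
  fixes c :: "'a \<Rightarrow> 'b"
  assumes "finite S" "\<forall>u\<in>S. \<forall>v\<in>S. {u, v} \<in> edges G \<longrightarrow> c u \<noteq> c v"
  shows "colorable_on (card (c ` S)) G S"
proof -
  obtain h :: "'b \<Rightarrow> nat" where h: "bij_betw h (c ` S) {0..<card (c ` S)}"
    using ex_bij_betw_finite_nat[of "c ` S"] assms(1) by blast
  then have "h (c u) \<noteq> h (c v)" if "u \<in> S" "v \<in> S" "{u, v} \<in> edges G" for u v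
    using that assms(2) by (metis bij_betw_imp_inj_on imageI inj_onD)
  moreover have "(h \<circ> c) ` S \<subseteq> {..<card (c ` S)}"
    using bij_betw_imp_surj_on[OF h] by (auto simp: image_comp[symmetric])
  ultimately show ?thesis unfolding colorable_on_def by (intro exI[of _ "h \<circ> c"]) auto
qed

lemma colorable_on_0: "colorable_on 0 G S \<longleftrightarrow> S = {}"
  by (auto simp: colorable_on_def)

lemma colorable_on_card:
  assumes "simple_graph G" "S \<subseteq> verts G"
  shows "colorable_on (card S) G S"
proof -
  have "finite S" using assms finite_subset by (auto simp: simple_graph_def)
  moreover have "{u, v} \<in> edges G \<Longrightarrow> u \<noteq> v" for u v
    using assms(1) by (auto simp: simple_graph_def)
  ultimately show ?thesis using colorable_on_card_image[of S G id] by auto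
qed

lemma colorable_on_verts_iff:
  assumes "simple_graph G"
  shows "colorable_on k G (verts G) \<longleftrightarrow> chromatic_number G \<le> k"
proof
  show "chromatic_number G \<le> k" if "colorable_on k G (verts G)"
    using that assms by (simp add: chromatic_number_def k_colorable_iff Least_le)
  have "k_colorable (card (verts G)) G"
    using assms by (simp add: k_colorable_iff colorable_on_card)
  then have "k_colorable (chromatic_number G) G"
    unfolding chromatic_number_def by (rule LeastI)
  then show "colorable_on k G (verts G)" if "chromatic_number G \<le> k"
    using that assms colorable_on_mono k_colorable_iff by blast
qed

lemma chromatic_number_eqI:
  assumes "simple_graph G" "\<And>k. colorable_on k G (verts G) \<longleftrightarrow> x \<le> k"
  shows "chromatic_number G = x"
proof -
  have "chromatic_number G \<le> k \<longleftrightarrow> x \<le> k" for k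
    using assms colorable_on_verts_iff by blast
  from this[of x] this[of "chromatic_number G"] show ?thesis by simp
qed

lemma maximal_k_colorable_extend:
  assumes "simple_graph G" "S \<subseteq> verts G" "colorable_on k G S"
  obtains T where "S \<subseteq> T" "maximal_k_colorable k G T"
proof -
  let ?F = "{T. T \<subseteq> verts G \<and> colorable_on k G T}"
  have "finite ?F" using assms(1) by (simp add: simple_graph_def)
  moreover have "S \<in> ?F" using assms(2,3) by simp
  ultimately obtain T where T: "T \<in> ?F" "S \<subseteq> T" "\<forall>U\<in>?F. T \<subseteq> U \<longrightarrow> T = U"
    using finite_has_maximal2[of ?F S] by blast
  have "maximal_k_colorable k G T" using T(1,3) unfolding maximal_k_colorable_iff by blast
  then show ?thesis using that T(2) by blast
qed

lemma maximal_k_colorable_exists: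
  assumes "simple_graph G"
  shows "\<exists>T. maximal_k_colorable k G T"
proof -
  have "colorable_on k G {}" by (simp add: colorable_on_def)
  then show ?thesis using maximal_k_colorable_extend[OF assms, of "{}" k] by blast
qed

text \<open>From the chromatic number on, the whole vertex set is colorable. Hence only
  \<open>k\<close> up to the chromatic number can distinguish well-hued graphs.\<close>

lemma maximal_k_colorable_verts:
  assumes "simple_graph G" "chromatic_number G \<le> k"
  shows "maximal_k_colorable k G S \<longleftrightarrow> S = verts G"
  using colorable_on_verts_iff[OF assms(1), of k] assms(2)
  unfolding maximal_k_colorable_iff by blast

section \<open>Large colorable subsets by averaging\<close>

text \<open>Among \<open>Suc k\<close> color classes partitioning \<open>S\<close>, a smallest one
  has at most the average size; \<open>T\<close> is what remains after deleting it.\<close>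

lemma colorable_on_remove_class:
  assumes "finite S" "colorable_on (Suc k) G S"
  obtains T where "T \<subseteq> S" "colorable_on k G T" "k * card S \<le> Suc k * card T"
proof -
  obtain c where c: "c ` S \<subseteq> {..<Suc k}" "\<forall>u\<in>S. \<forall>v\<in>S. {u, v} \<in> edges G \<longrightarrow> c u \<noteq> c v"
    using assms(2) by (auto simp: colorable_on_def)
  define A where "A i = {v \<in> S. c v = i}" for i
  have sum: "(\<Sum>i<Suc k. card (A i)) = card S"
    using sum_fun_comp[OF assms(1) finite_lessThan c(1), of "\<lambda>_. 1::nat"] by (simp add: A_def)
  have "\<exists>i<Suc k. Suc k * card (A i) \<le> card S"
  proof (rule ccontr)
    assume "\<not> ?thesis"
    then have "(\<Sum>i<Suc k. card S) < (\<Sum>i<Suc k. Suc k * card (A i))"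
      by (intro sum_strict_mono) (auto simp: not_le)
    also have "\<dots> = Suc k * card S" using sum by (simp only: sum_distrib_left[symmetric])
    finally show False by simp
  qed
  then obtain i where i: "i < Suc k" "Suc k * card (A i) \<le> card S" by blast
  let ?T = "S - A i"
  \<comment> \<open>The colors left may skip \<open>i\<close>, so they are counted here and
    renumbered afterwards.\<close>
  have "c ` ?T \<subseteq> {..<Suc k} - {i}" using c(1) by (auto simp: A_def)
  then have "card (c ` ?T) \<le> card ({..<Suc k} - {i})" by (intro card_mono) auto
  also have "\<dots> = k" using i(1) by simp
  finally have "colorable_on k G ?T"
    using colorable_on_card_image[of ?T G c] colorable_on_mono assms(1) c(2)
    by (metis Diff_iff finite_Diff subset_refl)
  moreover have "card ?T + card (A i) = card S"
  proof -
    have "A i \<subseteq> S" by (auto simp: A_def)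
    then show ?thesis
      using assms(1) by (simp add: card_Diff_subset card_mono finite_subset)
  qed
  then have "k * card S \<le> Suc k * card ?T"
    using i(2) by (simp add: distrib_left flip: \<open>card ?T + card (A i) = card S\<close>)
  ultimately show ?thesis using that[of ?T] by blast
qed

text \<open>Color classes are deleted one at a time, descending from \<open>x\<close> colors to
  \<open>k\<close>. The ratios \<open>k / Suc k\<close> telescope to \<open>k / x\<close>;
  everything is stated by products to avoid division.\<close>

lemma large_colorable_subset:
  assumes "finite S" "colorable_on x G S" "k \<le> x"
  obtains T where "T \<subseteq> S" "colorable_on k G T" "k * card S \<le> x * card T"
proof -
  have "\<exists>T\<subseteq>S. colorable_on k G T \<and> k * card S \<le> x * card T"
    using assms(3)
  proof (induction k rule: inc_induct)
    case base
    then show ?case using assms(2) by blast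
  next
    case (step k)
    then obtain T where T: "T \<subseteq> S" "colorable_on (Suc k) G T" "Suc k * card S \<le> x * card T"
      by blast
    obtain U where U: "U \<subseteq> T" "colorable_on k G U" "k * card T \<le> Suc k * card U"
      using colorable_on_remove_class T finite_subset[OF _ assms(1)] by metis
    \<comment> \<open>The bound for \<open>T\<close> is scaled by \<open>k\<close> and the one for
      \<open>U\<close> by \<open>x\<close>, so that they chain; the factor \<open>Suc k\<close> then
      cancels.\<close>
    have "Suc k * (k * card S) \<le> k * (x * card T)"
      using mult_le_mono2[OF T(3), of k] by (simp only: mult.left_commute)
    also have "\<dots> \<le> Suc k * (x * card U)"
      using mult_le_mono2[OF U(3), of x] by (simp only: mult.left_commute)
    finally have "k * card S \<le> x * card U" by (simp only: mult_le_cancel1 zero_less_Suc simp_thms)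
    then show ?case using T(1) U(1,2) by blast
  qed
  then show ?thesis using that by blast
qed

lemma large_maximal_k_colorable:
  assumes "simple_graph G" "k \<le> chromatic_number G"
  obtains T where "maximal_k_colorable k G T"
    "k * card (verts G) \<le> chromatic_number G * card T"
proof -
  have fin: "finite (verts G)" using assms(1) by (simp add: simple_graph_def)
  have col: "colorable_on (chromatic_number G) G (verts G)"
    using colorable_on_verts_iff[OF assms(1)] by simp
  obtain T where T: "T \<subseteq> verts G" "colorable_on k G T"
    "k * card (verts G) \<le> chromatic_number G * card T"
    using large_colorable_subset[OF fin col assms(2)] .
  obtain U where U: "T \<subseteq> U" "maximal_k_colorable k G U"
    using maximal_k_colorable_extend[OF assms(1) T(1,2)] .
  then have "finite U" using fin finite_subset by (auto simp: maximal_k_colorable_iff)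
  then have "card T \<le> card U" using U(1) by (rule card_mono)
  then show ?thesis using that[OF U(2)] T(3) mult_le_mono2 le_trans by blast
qed

subsection \<open>Disjoint unions and joins\<close>

lemma simple_graph_union:
  assumes "simple_graph G" "simple_graph H"
  shows "simple_graph (graph_union G H)"
  using assms by (auto simp: simple_graph_def graph_union_def)

lemma simple_graph_join:
  assumes "simple_graph G" "simple_graph H" "verts G \<inter> verts H = {}"
  shows "simple_graph (graph_join G H)"
proof -
  have "card {u, v} = 2" if "u \<in> verts G" "v \<in> verts H" for u v
    using assms(3) that by (metis card_2_iff disjoint_iff)
  with assms show ?thesis by (auto simp: simple_graph_def graph_join_def)
qed

lemma verts_graph_union [simp]: "verts (graph_union G H) = verts G \<union> verts H"
  by (simp add: graph_union_def)

lemma verts_graph_join [simp]: "verts (graph_join G H) = verts G \<union> verts H"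
  by (simp add: graph_join_def)

locale disjoint_graphs =
  fixes G H :: "'a graph"
  assumes simple_G: "simple_graph G" and simple_H: "simple_graph H"
    and disjoint: "verts G \<inter> verts H = {}"
begin

lemma edge_G: "{u, v} \<in> edges G \<Longrightarrow> u \<in> verts G \<and> v \<in> verts G"
  using simple_G by (auto simp: simple_graph_def)

lemma edge_H: "{u, v} \<in> edges H \<Longrightarrow> u \<in> verts H \<and> v \<in> verts H"
  using simple_H by (auto simp: simple_graph_def)

lemma finite_G: "S \<subseteq> verts G \<Longrightarrow> finite S"
  using simple_G finite_subset by (auto simp: simple_graph_def)

lemma finite_H: "S \<subseteq> verts H \<Longrightarrow> finite S"
  using simple_H finite_subset by (auto simp: simple_graph_def)

lemma card_Un: "S \<subseteq> verts G \<Longrightarrow> T \<subseteq> verts H \<Longrightarrow> card (S \<union> T) = card S + card T"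
  using disjoint finite_G finite_H by (intro card_Un_disjoint) auto

lemma Un_cases:
  assumes "S \<subseteq> verts G \<union> verts H"
  obtains A B where "A \<subseteq> verts G" "B \<subseteq> verts H" "S = A \<union> B"
proof
  show "S \<inter> verts G \<subseteq> verts G" "S \<inter> verts H \<subseteq> verts H" by auto
  show "S = (S \<inter> verts G) \<union> (S \<inter> verts H)" using assms by auto
qed

lemma Un_subset_Un_iff:
  assumes "A \<subseteq> verts G" "B \<subseteq> verts H" "A' \<subseteq> verts G" "B' \<subseteq> verts H"
  shows "A \<union> B \<subseteq> A' \<union> B' \<longleftrightarrow> A \<subseteq> A' \<and> B \<subseteq> B'"
  using assms disjoint by blast

lemma Un_eq_Un_iff:
  assumes "A \<subseteq> verts G" "B \<subseteq> verts H" "A' \<subseteq> verts G" "B' \<subseteq> verts H"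
  shows "A \<union> B = A' \<union> B' \<longleftrightarrow> A = A' \<and> B = B'"
  using assms disjoint by blast

text \<open>No edge runs between the two parts, so colorings with the same palette can be
  glued.\<close>

lemma colorable_on_union:
  assumes "A \<subseteq> verts G" "B \<subseteq> verts H"
  shows "colorable_on k (graph_union G H) (A \<union> B) \<longleftrightarrow> colorable_on k G A \<and> colorable_on k H B"
    (is "?L \<longleftrightarrow> ?R")
proof
  assume ?L
  then show ?R by (fastforce simp: colorable_on_def graph_union_def)
next
  assume ?R
  then obtain c d where c: "c ` A \<subseteq> {..<k}" "\<forall>u\<in>A. \<forall>v\<in>A. {u, v} \<in> edges G \<longrightarrow> c u \<noteq> c v"
    and d: "d ` B \<subseteq> {..<k}" "\<forall>u\<in>B. \<forall>v\<in>B. {u, v} \<in> edges H \<longrightarrow> d u \<noteq> d v"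
    by (auto simp: colorable_on_def)
  let ?c = "\<lambda>v. if v \<in> verts G then c v else d v"
  have *: "v \<in> A \<Longrightarrow> v \<in> verts G" "v \<in> B \<Longrightarrow> v \<notin> verts G" "v \<in> B \<Longrightarrow> v \<in> verts H"
    "v \<in> verts H \<Longrightarrow> v \<notin> verts G" for v
    using assms disjoint by auto
  have "?c ` (A \<union> B) \<subseteq> {..<k}" using c(1) d(1) * by auto
  moreover have "?c u \<noteq> ?c v"
    if "u \<in> A \<union> B" "v \<in> A \<union> B" "{u, v} \<in> edges G \<union> edges H" for u v
    using that c(2) d(2) * edge_G edge_H by (metis Un_iff)
  ultimately show ?L
    unfolding colorable_on_def graph_union_def by (intro exI[of _ ?c]) auto
qed

text \<open>All edges between \<open>A\<close> and \<open>B\<close> are present, so the two parts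
  use disjoint sets of colors and share out the palette. Conversely, the colors on \<open>B\<close>
  are shifted past those on \<open>A\<close>.\<close>

lemma colorable_on_join:
  assumes "A \<subseteq> verts G" "B \<subseteq> verts H"
  shows "colorable_on k (graph_join G H) (A \<union> B) \<longleftrightarrow>
    (\<exists>i j. i + j = k \<and> colorable_on i G A \<and> colorable_on j H B)"
    (is "?L \<longleftrightarrow> ?R")
proof
  assume ?L
  then obtain c where c: "c ` (A \<union> B) \<subseteq> {..<k}"
    "\<forall>u\<in>A \<union> B. \<forall>v\<in>A \<union> B. {u, v} \<in> edges (graph_join G H) \<longrightarrow> c u \<noteq> c v"
    unfolding colorable_on_def by blast
  have col: "colorable_on (card (c ` A)) G A" "colorable_on (card (c ` B)) H B"
    using c(2) finite_G[OF assms(1)] finite_H[OF assms(2)]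
    by (simp_all add: colorable_on_card_image graph_join_def)
  have "c u \<noteq> c v" if "u \<in> A" "v \<in> B" for u v
  proof (rule c(2)[rule_format])
    have "u \<in> verts G" "v \<in> verts H" using that assms by auto
    then show "{u, v} \<in> edges (graph_join G H)" unfolding graph_join_def by auto
  qed (use that in auto)
  then have "c ` A \<inter> c ` B = {}" by blast
  then have "card (c ` A) + card (c ` B) = card (c ` (A \<union> B))"
    using finite_G[OF assms(1)] finite_H[OF assms(2)] by (simp add: image_Un card_Un_disjoint)
  also have "\<dots> \<le> k" using card_mono[OF _ c(1)] by simp
  finally have "card (c ` A) + (k - card (c ` A)) = k" "card (c ` B) \<le> k - card (c ` A)" by auto
  then show ?R using col colorable_on_mono by blast
next
  assume ?R
  then obtain i j c d where k: "i + j = k"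
    and c: "c ` A \<subseteq> {..<i}" "\<forall>u\<in>A. \<forall>v\<in>A. {u, v} \<in> edges G \<longrightarrow> c u \<noteq> c v"
    and d: "d ` B \<subseteq> {..<j}" "\<forall>u\<in>B. \<forall>v\<in>B. {u, v} \<in> edges H \<longrightarrow> d u \<noteq> d v"
    by (auto simp: colorable_on_def)
  let ?c = "\<lambda>v. if v \<in> verts G then c v else i + d v"
  have *: "v \<in> A \<Longrightarrow> v \<in> verts G" "v \<in> B \<Longrightarrow> v \<notin> verts G" "v \<in> B \<Longrightarrow> v \<in> verts H"
    "v \<in> verts H \<Longrightarrow> v \<notin> verts G" for v
    using assms disjoint by auto
  have lt: "v \<in> A \<Longrightarrow> c v < i" "v \<in> B \<Longrightarrow> d v < j" for v using c(1) d(1) by auto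
  have "?c ` (A \<union> B) \<subseteq> {..<k}" using lt k * by (fastforce simp: image_iff)
  moreover have "?c u \<noteq> ?c v"
    if uv: "u \<in> A \<union> B" "v \<in> A \<union> B" "{u, v} \<in> edges (graph_join G H)" for u v
  proof -
    consider "{u, v} \<in> edges G" | "{u, v} \<in> edges H"
      | "u \<in> verts G" "v \<in> verts H" | "v \<in> verts G" "u \<in> verts H"
      using uv(3) by (auto simp: graph_join_def doubleton_eq_iff)
    then show ?thesis
    proof cases
      case 1
      then show ?thesis using uv c(2) * edge_G by (metis Un_iff)
    next
      case 2
      then show ?thesis using uv d(2) * edge_H by (metis Un_iff add_left_cancel)
    next
      case 3
      then show ?thesis using uv * lt by (metis Un_iff not_add_less1)
    next
      case 4
      then show ?thesis using uv * lt by (metis Un_iff not_add_less1)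
    qed
  qed
  ultimately show ?L
    unfolding colorable_on_def by (intro exI[of _ ?c]) blast
qed

lemma chromatic_number_union:
  "chromatic_number (graph_union G H) = max (chromatic_number G) (chromatic_number H)"
  using simple_graph_union[OF simple_G simple_H]
  by (rule chromatic_number_eqI)
     (simp add: colorable_on_union colorable_on_verts_iff simple_G simple_H)

lemma chromatic_number_join:
  "chromatic_number (graph_join G H) = chromatic_number G + chromatic_number H"
proof (rule chromatic_number_eqI[OF simple_graph_join[OF simple_G simple_H disjoint]])
  have "(\<exists>i j. i + j = k \<and> a \<le> i \<and> b \<le> j) \<longleftrightarrow> a + b \<le> k" for a b k :: nat
    by presburger
  then show "colorable_on k (graph_join G H) (verts (graph_join G H)) \<longleftrightarrow>
    chromatic_number G + chromatic_number H \<le> k" for k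
    by (simp add: colorable_on_join colorable_on_verts_iff simple_G simple_H)
qed

text \<open>Both parts have all \<open>k\<close> colors at their disposal, so each can be enlarged
  independently of the other.\<close>

lemma maximal_k_colorable_union:
  assumes "A \<subseteq> verts G" "B \<subseteq> verts H"
  shows "maximal_k_colorable k (graph_union G H) (A \<union> B) \<longleftrightarrow>
    maximal_k_colorable k G A \<and> maximal_k_colorable k H B" (is "?L \<longleftrightarrow> ?R")
proof
  assume L: ?L
  have max: "A' = A \<and> B' = B" if "A \<subseteq> A'" "B \<subseteq> B'" "A' \<subseteq> verts G" "B' \<subseteq> verts H"
    "colorable_on k G A'" "colorable_on k H B'" for A' B'
  proof -
    have "A \<union> B \<subseteq> A' \<union> B'" "A' \<union> B' \<subseteq> verts (graph_union G H)"
      using that(1-4) by auto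
    moreover have "colorable_on k (graph_union G H) (A' \<union> B')"
      using that(3-6) colorable_on_union by simp
    ultimately have "A' \<union> B' = A \<union> B" using L by (simp add: maximal_k_colorable_iff)
    then show ?thesis using Un_eq_Un_iff[OF that(3,4) assms] by simp
  qed
  have col: "colorable_on k G A" "colorable_on k H B"
    using L assms colorable_on_union by (auto simp: maximal_k_colorable_iff)
  \<comment> \<open>Each instance of \<open>max\<close> enlarges one part and keeps the other
    fixed.\<close>
  show ?R
    using max[OF _ subset_refl _ assms(2) _ col(2)] max[OF subset_refl _ assms(1) _ col(1)] col assms
    by (simp add: maximal_k_colorable_iff)
next
  assume R: ?R
  have "T = A \<union> B" if T: "A \<union> B \<subseteq> T" "T \<subseteq> verts G \<union> verts H"
    "colorable_on k (graph_union G H) T" for T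
  proof -
    obtain A' B' where T': "A' \<subseteq> verts G" "B' \<subseteq> verts H" "T = A' \<union> B'"
      using Un_cases T(2) .
    then have "A \<subseteq> A'" "B \<subseteq> B'" using Un_subset_Un_iff[OF assms T'(1,2)] T(1) by simp_all
    moreover have "colorable_on k G A'" "colorable_on k H B'"
      using T(3) T' colorable_on_union by simp_all
    ultimately show ?thesis
      using R T' maximal_k_colorableD[of k G A A'] maximal_k_colorableD[of k H B B'] by simp
  qed
  moreover have "colorable_on k (graph_union G H) (A \<union> B)"
    using R assms by (simp add: colorable_on_union maximal_k_colorable_iff)
  ultimately show ?L using assms by (auto simp: maximal_k_colorable_iff)
qed

end

subsection \<open>Balanced graphs\<close>

text \<open>The linear form \<open>k * m\<close> replaces the fraction of the vertex count; when
  \<open>x\<close> is positive, \<open>m\<close> is the common order of the maximal independent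
  sets. The case \<open>k = 0\<close> is harmless, since only the empty set is colorable with no
  colors.\<close>

definition balanced :: "'a graph \<Rightarrow> nat \<Rightarrow> nat \<Rightarrow> bool" where
  "balanced G x m \<longleftrightarrow> chromatic_number G = x \<and>
     (\<forall>k\<le>x. \<forall>S. maximal_k_colorable k G S \<longrightarrow> card S = k * m)"

lemma balanced_card_verts:
  assumes "simple_graph G" "balanced G x m"
  shows "card (verts G) = x * m"
  using assms maximal_k_colorable_verts[OF assms(1)] by (auto simp: balanced_def)

lemma chromatic_number_pos:
  assumes "simple_graph G" "verts G \<noteq> {}"
  shows "chromatic_number G > 0"
  using assms colorable_on_verts_iff[OF assms(1), of 0] by (simp add: colorable_on_0)

text \<open>The prescribed orders are linear in \<open>i\<close>, so the one for
  \<open>i = 1\<close> serves as \<open>m\<close>. Nonemptiness makes the chromatic number positive,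
  which puts \<open>1\<close> in range and justifies the division.\<close>

lemma well_equi_hued_iff_balanced:
  assumes G: "simple_graph G" and ne: "verts G \<noteq> {}"
  shows "well_equi_hued G \<longleftrightarrow> (\<exists>m. balanced G (chromatic_number G) m)"
proof
  let ?x = "chromatic_number G"
  have pos: "?x > 0" using chromatic_number_pos assms .
  {
    assume weh: "well_equi_hued G"
    have ord: "card S = hued_order G k" if "k \<ge> 1" "maximal_k_colorable k G S" for k S
    proof -
      have "card T = card S" if "maximal_k_colorable k G T" for T
        using weh that \<open>k \<ge> 1\<close> \<open>maximal_k_colorable k G S\<close>
        unfolding well_equi_hued_def well_hued_def by blast
      then show ?thesis unfolding hued_order_def
        using that(2) by (intro the_equality[symmetric]) blast+
    qed
    have eq: "real (hued_order G i) = real i / real ?x * real (card (verts G))" if "1 \<le> i" "i \<le> ?x" for i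
      using weh that unfolding well_equi_hued_def by simp
    have "card S = k * hued_order G 1" if k: "k \<le> ?x" and S: "maximal_k_colorable k G S" for k S
    proof (cases "k = 0")
      case True
      then show ?thesis using S by (simp add: maximal_k_colorable_iff colorable_on_0)
    next
      case False
      then have "real (card S) = real k * (real 1 / real ?x * real (card (verts G)))"
        using ord[OF _ S] eq[of k] k by simp
      also have "\<dots> = real (k * hued_order G 1)" using eq[of 1] pos by simp
      finally show ?thesis using of_nat_eq_iff by blast
    qed
    then show "\<exists>m. balanced G ?x m" unfolding balanced_def by blast
  }
  {
    assume "\<exists>m. balanced G ?x m"
    then obtain m where m: "balanced G ?x m" by blast
    have "well_hued G" unfolding well_hued_def
    proof (intro allI impI)
      fix k S T assume "maximal_k_colorable k G S" "maximal_k_colorable k G T"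
      then show "card S = card T"
        \<comment> \<open>Up to the chromatic number the order is fixed by balance; beyond it, both
          sets are the whole vertex set.\<close>
        using m maximal_k_colorable_verts[OF G, of k] unfolding balanced_def
        by (metis nat_le_linear)
    qed
    moreover have "hued_order G i = i * m" if "i \<le> ?x" for i
    proof -
      obtain S where "maximal_k_colorable i G S" using maximal_k_colorable_exists[OF G] by blast
      then show ?thesis unfolding hued_order_def
        using m that unfolding balanced_def by (intro the_equality) blast+
    qed
    ultimately show "well_equi_hued G"
      using balanced_card_verts[OF G m] pos by (simp add: well_equi_hued_def)
  }
qed

section \<open>Balance of disjoint unions and of joins\<close>

context disjoint_graphs
begin

lemma balanced_unionI:
  assumes "balanced G x m" "balanced H x n"
  shows "balanced (graph_union G H) x (m + n)"
  unfolding balanced_def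
proof (intro conjI allI impI)
  show "chromatic_number (graph_union G H) = x"
    using assms chromatic_number_union by (simp add: balanced_def)
  fix k S assume k: "k \<le> x" and S: "maximal_k_colorable k (graph_union G H) S"
  then have "S \<subseteq> verts G \<union> verts H" by (simp add: maximal_k_colorable_iff)
  then obtain A B where AB: "A \<subseteq> verts G" "B \<subseteq> verts H" "S = A \<union> B" by (rule Un_cases)
  then show "card S = k * (m + n)"
    using S k assms maximal_k_colorable_union[OF AB(1,2), of k] card_Un[OF AB(1,2)]
    by (auto simp: balanced_def distrib_left)
qed

text \<open>Averaging bounds the orders in each part from below, while balance of the union fixes
  their sums. Equality is thus forced, first for \<open>k = 1\<close>, where it shows that the
  chromatic numbers agree, and then for every \<open>k\<close>.\<close>

lemma balanced_unionD:
  assumes ne: "verts G \<noteq> {}" "verts H \<noteq> {}"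
    and bal: "balanced (graph_union G H) x m"
  shows "\<exists>p q. p + q = m \<and> balanced G x p \<and> balanced H x q"
proof -
  let ?y = "chromatic_number G" and ?z = "chromatic_number H"
  have x: "x = max ?y ?z" using bal chromatic_number_union by (simp add: balanced_def)
  have pos: "?y > 0" "?z > 0" using chromatic_number_pos simple_G simple_H ne by blast+
  have n: "card (verts G) + card (verts H) = x * m"
    using balanced_card_verts[OF simple_graph_union[OF simple_G simple_H] bal] card_Un by simp
  have npos: "card (verts G) > 0" "card (verts H) > 0"
    using ne finite_G finite_H by (simp_all add: card_gt_0_iff)
  obtain I where I: "\<And>k. maximal_k_colorable k G (I k)"
    using maximal_k_colorable_exists[OF simple_G] by metis
  obtain J where J: "\<And>k. maximal_k_colorable k H (J k)"
    using maximal_k_colorable_exists[OF simple_H] by metis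
  have sum: "card A + card B = k * m"
    if "maximal_k_colorable k G A" "maximal_k_colorable k H B" "k \<le> x" for k A B
  proof -
    have AB: "A \<subseteq> verts G" "B \<subseteq> verts H" using that by (auto simp: maximal_k_colorable_iff)
    then have "maximal_k_colorable k (graph_union G H) (A \<union> B)"
      using maximal_k_colorable_union that by blast
    then show ?thesis using bal that(3) card_Un[OF AB] by (simp add: balanced_def)
  qed
  \<comment> \<open>With \<open>J k\<close> held fixed in \<open>H\<close>, the constant sum
    determines the order of \<open>A\<close>.\<close>
  have cardA: "card A = card (I k)" if "maximal_k_colorable k G A" "k \<le> x" for k A
    using sum[OF that(1) J that(2)] sum[OF I J that(2)] by linarith
  have cardB: "card B = card (J k)" if "maximal_k_colorable k H B" "k \<le> x" for k B
    using sum[OF I that(1,2)] sum[OF I J that(2)] by linarith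
  have lowA: "k * card (verts G) \<le> ?y * card (I k)" if k: "k \<le> ?y" for k
  proof -
    obtain U where U: "maximal_k_colorable k G U" "k * card (verts G) \<le> ?y * card U"
      using large_maximal_k_colorable[OF simple_G k] .
    then show ?thesis using cardA[OF U(1)] k x by simp
  qed
  have lowB: "k * card (verts H) \<le> ?z * card (J k)" if k: "k \<le> ?z" for k
  proof -
    obtain U where U: "maximal_k_colorable k H U" "k * card (verts H) \<le> ?z * card U"
      using large_maximal_k_colorable[OF simple_H k] .
    then show ?thesis using cardB[OF U(1)] k x by simp
  qed
  have low1: "card (verts G) \<le> ?y * card (I 1)" "card (verts H) \<le> ?z * card (J 1)"
    using lowA[of 1] lowB[of 1] pos by auto
  have sum1: "card (I 1) + card (J 1) = m" using sum[OF I J, of 1] x pos by simp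
  have eq: "x * card (I 1) + x * card (J 1) = card (verts G) + card (verts H)"
    using n sum1 by (metis distrib_left)
  have le: "?y * card (I 1) \<le> x * card (I 1)" "?z * card (J 1) \<le> x * card (J 1)"
    using x by auto
  \<comment> \<open>The vertex count is at most \<open>?y * card (I 1) + ?z * card (J 1)\<close>,
    which is at most \<open>x * m\<close>, which is the vertex count again; so every inequality is
    tight.\<close>
  have "?y * card (I 1) = x * card (I 1)" "?z * card (J 1) = x * card (J 1)"
    using low1 le eq by linarith+
  moreover have "card (I 1) > 0" "card (J 1) > 0" using low1 npos by (auto intro: Nat.gr0I)
  ultimately have y: "?y = x" and z: "?z = x" by auto
  have nG: "card (verts G) = x * card (I 1)" and nH: "card (verts H) = x * card (J 1)"
    using low1 eq unfolding y z by linarith+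
  have main: "card (I k) = k * card (I 1) \<and> card (J k) = k * card (J 1)" if k: "k \<le> x" for k
  proof -
    \<comment> \<open>The averaging bounds are now read with both chromatic numbers equal to
      \<open>x\<close>, and \<open>x\<close> cancels. The resulting lower bounds already add up to
      the exact sum \<open>k * m\<close>.\<close>
    have "x * (k * card (I 1)) \<le> x * card (I k)" "x * (k * card (J 1)) \<le> x * card (J k)"
      using lowA[of k] lowB[of k] k unfolding y z nG nH by (simp_all add: mult.left_commute)
    then have "k * card (I 1) \<le> card (I k)" "k * card (J 1) \<le> card (J k)"
      using pos y z by auto
    moreover have "card (I k) + card (J k) = k * card (I 1) + k * card (J 1)"
      using sum[OF I J k] sum1 by (metis distrib_left)
    ultimately show ?thesis by linarith
  qed
  have "balanced G x (card (I 1))" "balanced H x (card (J 1))"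
    using y z main cardA cardB by (auto simp: balanced_def)
  then show ?thesis using sum1 by blast
qed

text \<open>The palette of a maximal set can be divided so that neither part is allotted more colors
  than its chromatic number. Each part is then maximal for its share, and the orders add to
  \<open>k * m\<close> because the factor \<open>m\<close> is common.\<close>

lemma balanced_joinI:
  assumes G: "balanced G x m" and H: "balanced H y m"
  shows "balanced (graph_join G H) (x + y) m"
  unfolding balanced_def
proof (intro conjI allI impI)
  have x: "chromatic_number G = x" and y: "chromatic_number H = y"
    using assms by (auto simp: balanced_def)
  show "chromatic_number (graph_join G H) = x + y"
    using x y chromatic_number_join by simp
  fix k S assume k: "k \<le> x + y" and S: "maximal_k_colorable k (graph_join G H) S"
  then have "S \<subseteq> verts G \<union> verts H" by (simp add: maximal_k_colorable_iff)
  then obtain A B where AB: "A \<subseteq> verts G" "B \<subseteq> verts H" "S = A \<union> B" by (rule Un_cases)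
  have colS: "colorable_on k (graph_join G H) (A \<union> B)"
    using S AB by (simp add: maximal_k_colorable_iff)
  then obtain i j where ij: "i + j = k" "colorable_on i G A" "colorable_on j H B"
    using colorable_on_join[OF AB(1,2)] by blast
  have A: "colorable_on x G A"
    using x AB(1) colorable_on_verts_iff[OF simple_G, of x] colorable_on_mono[of x G "verts G" x A]
    by simp
  have B: "colorable_on y H B"
    using y AB(2) colorable_on_verts_iff[OF simple_H, of y] colorable_on_mono[of y H "verts H" y B]
    by simp
  \<comment> \<open>If one part holds more colors than its chromatic number, the surplus goes to the
    other, which can absorb it because \<open>k \<le> x + y\<close>. The part that loses colors
    keeps enough to color all its vertices.\<close>
  define i' where "i' = (if i \<le> x then if j \<le> y then i else k - y else x)"
  define j' where "j' = k - i'"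
  have ij': "i' + j' = k" "i' \<le> x" "j' \<le> y"
    using ij(1) k unfolding i'_def j'_def by auto
  have "colorable_on i' G A"
    using A ij k colorable_on_mono[OF ij(2), of i'] by (auto simp: i'_def)
  moreover have "colorable_on j' H B"
    using B ij k colorable_on_mono[OF ij(3), of j'] by (auto simp: i'_def j'_def)
  ultimately have col: "colorable_on i' G A" "colorable_on j' H B" .
  have max: "T = A \<union> B" if "A \<union> B \<subseteq> T" "T \<subseteq> verts G \<union> verts H"
    "colorable_on k (graph_join G H) T" for T
    using S AB that by (simp add: maximal_k_colorable_iff)
  have "A' = A" if "A \<subseteq> A'" "A' \<subseteq> verts G" "colorable_on i' G A'" for A'
  proof -
    have "colorable_on k (graph_join G H) (A' \<union> B)"
      using that(3) col(2) ij'(1) colorable_on_join[OF that(2) AB(2), of k] by blast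
    moreover have "A \<union> B \<subseteq> A' \<union> B" "A' \<union> B \<subseteq> verts G \<union> verts H"
      using that(1,2) AB(2) by auto
    ultimately have "A' \<union> B = A \<union> B" by (intro max)
    then show ?thesis using Un_eq_Un_iff[OF that(2) AB(2) AB(1,2)] by simp
  qed
  then have mA: "maximal_k_colorable i' G A" using AB col by (auto simp: maximal_k_colorable_iff)
  have "B' = B" if "B \<subseteq> B'" "B' \<subseteq> verts H" "colorable_on j' H B'" for B'
  proof -
    have "colorable_on k (graph_join G H) (A \<union> B')"
      using that(3) col(1) ij'(1) colorable_on_join[OF AB(1) that(2), of k] by blast
    moreover have "A \<union> B \<subseteq> A \<union> B'" "A \<union> B' \<subseteq> verts G \<union> verts H"
      using that(1,2) AB(1) by auto
    ultimately have "A \<union> B' = A \<union> B" by (intro max)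
    then show ?thesis using Un_eq_Un_iff[OF AB(1) that(2) AB(1,2)] by simp
  qed
  then have mB: "maximal_k_colorable j' H B" using AB col by (auto simp: maximal_k_colorable_iff)
  have "card A = i' * m" "card B = j' * m"
    using mA mB G H ij' by (auto simp: balanced_def)
  then show "card S = k * m" using AB card_Un ij' by (simp add: distrib_right[symmetric])
qed

text \<open>A maximal \<open>k\<close>-colorable subgraph of \<open>G\<close> together with all of \<open>H\<close> is a maximal
  \<open>(k + \<chi>(H))\<close>-colorable subgraph of the join.\<close>

lemma balanced_join_left:
  assumes bal: "balanced (graph_join G H) x m"
    and H: "card (verts H) = chromatic_number H * m"
  shows "balanced G (chromatic_number G) m"
  unfolding balanced_def
proof (intro conjI allI impI refl)
  let ?z = "chromatic_number H"
  have x: "x = chromatic_number G + ?z"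
    using bal chromatic_number_join by (simp add: balanced_def)
  fix k S assume k: "k \<le> chromatic_number G" and S: "maximal_k_colorable k G S"
  then have sub: "S \<subseteq> verts G" by (simp add: maximal_k_colorable_iff)
  have "colorable_on (k + ?z) (graph_join G H) (S \<union> verts H)"
    using S colorable_on_join[OF sub subset_refl] colorable_on_verts_iff[OF simple_H]
    by (auto simp: maximal_k_colorable_iff)
  moreover have "T = S \<union> verts H" if T: "S \<union> verts H \<subseteq> T" "T \<subseteq> verts G \<union> verts H"
    "colorable_on (k + ?z) (graph_join G H) T" for T
  proof -
    obtain A B where AB: "A \<subseteq> verts G" "B \<subseteq> verts H" "T = A \<union> B" using Un_cases T(2) .
    then have B: "B = verts H" and SA: "S \<subseteq> A"
      using Un_subset_Un_iff[OF sub subset_refl AB(1,2)] T(1) by auto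
    obtain i j where ij: "i + j = k + ?z" "colorable_on i G A" "colorable_on j H B"
      using T(3) AB colorable_on_join by blast
    \<comment> \<open>Coloring all of \<open>H\<close> takes at least \<open>?z\<close> colors,
      which leaves at most \<open>k\<close> for \<open>A\<close>.\<close>
    then have "?z \<le> j" using B colorable_on_verts_iff[OF simple_H] by simp
    then have "colorable_on k G A" using ij colorable_on_mono[OF ij(2)] by simp
    then show ?thesis using maximal_k_colorableD[OF S SA AB(1)] AB(3) B by simp
  qed
  ultimately have "maximal_k_colorable (k + ?z) (graph_join G H) (S \<union> verts H)"
    using sub by (auto simp: maximal_k_colorable_iff)
  then have "card (S \<union> verts H) = (k + ?z) * m"
    using bal k x by (simp add: balanced_def)
  then show "card S = k * m" using card_Un[OF sub subset_refl] H by (simp add: distrib_right)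
qed

lemma graph_join_commute: "graph_join G H = graph_join H G"
proof -
  have "{{u, v} |u v. u \<in> verts G \<and> v \<in> verts H} = {{u, v} |u v. u \<in> verts H \<and> v \<in> verts G}"
    by (auto simp: insert_commute)
  then show ?thesis by (simp add: graph_join_def Un_ac)
qed

text \<open>Averaging yields an independent set of \<open>G\<close> with at least the average class
  size. It extends to a maximal independent set of the join, whose order is \<open>m\<close>;
  \<open>x > 0\<close> brings \<open>k = 1\<close> into the range of balance.\<close>

lemma card_verts_join_le:
  assumes bal: "balanced (graph_join G H) x m" and "x > 0"
  shows "card (verts G) \<le> chromatic_number G * m"
proof (cases "verts G = {}")
  case False
  let ?y = "chromatic_number G"
  have "1 \<le> ?y" using chromatic_number_pos[OF simple_G False] by simp
  then obtain T where T: "maximal_k_colorable 1 G T" "1 * card (verts G) \<le> ?y * card T"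
    by (rule large_maximal_k_colorable[OF simple_G])
  have sub: "T \<subseteq> verts G" and "colorable_on 1 G T"
    using T(1) by (simp_all add: maximal_k_colorable_iff)
  moreover have "colorable_on 0 H {}" by (simp add: colorable_on_0)
  ultimately have "colorable_on (1 + 0) (graph_join G H) (T \<union> {})"
    using colorable_on_join[OF sub empty_subsetI] by blast
  then obtain U where U: "T \<subseteq> U" "maximal_k_colorable 1 (graph_join G H) U"
    using maximal_k_colorable_extend[OF simple_graph_join[OF simple_G simple_H disjoint], of T 1] sub
    by auto
  then have "card U = 1 * m"
    using bal \<open>x > 0\<close> unfolding balanced_def by (metis One_nat_def Suc_leI)
  then have "card U = m" by simp
  moreover have "finite U"
    using U(2) finite_G finite_H finite_subset[of U "verts G \<union> verts H"]
    by (auto simp: maximal_k_colorable_iff)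
  ultimately have "card T \<le> m" using card_mono[of U T] U(1) by simp
  then have "?y * card T \<le> ?y * m" by (rule mult_le_mono2)
  then show ?thesis using T(2) by linarith
qed simp

end

lemma simple_graph_complement: "simple_graph G \<Longrightarrow> simple_graph (complement G)"
  by (simp add: simple_graph_def complement_def)

lemma verts_complement [simp]: "verts (complement G) = verts G"
  by (simp add: complement_def)

lemma disjoint_graphs_sym: "disjoint_graphs G H \<Longrightarrow> disjoint_graphs H G"
  by (auto simp: disjoint_graphs_def)

section \<open>Splitting balanced joins, and complements of unions and joins\<close>

context disjoint_graphs
begin

text \<open>The upper bounds on the two vertex counts add up to the vertex count of the join, so
  both are equalities. This is what \<open>balanced_join_left\<close> asks of the other
  part.\<close>

lemma balanced_joinD:
  assumes "verts G \<noteq> {}" and bal: "balanced (graph_join G H) x m"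
  shows "\<exists>p q. p + q = x \<and> balanced G p m \<and> balanced H q m"
proof -
  interpret HG: disjoint_graphs H G
    using disjoint_graphs_sym disjoint_graphs_axioms .
  let ?y = "chromatic_number G" and ?z = "chromatic_number H"
  have bal': "balanced (graph_join H G) x m" using bal graph_join_commute by simp
  have x: "?y + ?z = x" using bal chromatic_number_join by (simp add: balanced_def)
  then have "x > 0" using chromatic_number_pos[OF simple_G assms(1)] by simp
  then have le: "card (verts G) \<le> ?y * m" "card (verts H) \<le> ?z * m"
    using card_verts_join_le[OF bal] HG.card_verts_join_le[OF bal'] by auto
  have "card (verts G) + card (verts H) = x * m"
    using balanced_card_verts[OF simple_graph_join[OF simple_G simple_H disjoint] bal] card_Un
    by simp
  also have "\<dots> = ?y * m + ?z * m" using x by (simp add: distrib_right[symmetric])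
  finally have "card (verts G) = ?y * m" "card (verts H) = ?z * m" using le by linarith+
  then have "balanced G ?y m" "balanced H ?z m"
    using balanced_join_left[OF bal] HG.balanced_join_left[OF bal'] by auto
  then show ?thesis using x by blast
qed

lemma balanced_union_iff:
  assumes "verts G \<noteq> {}" "verts H \<noteq> {}"
  shows "balanced (graph_union G H) x m \<longleftrightarrow>
    (\<exists>p q. p + q = m \<and> balanced G x p \<and> balanced H x q)"
  using balanced_unionD[OF assms, of x m] balanced_unionI[of x] by blast

lemma balanced_join_iff:
  assumes "verts G \<noteq> {}"
  shows "balanced (graph_join G H) x m \<longleftrightarrow>
    (\<exists>p q. p + q = x \<and> balanced G p m \<and> balanced H q m)"
  using balanced_joinD[OF assms, of x m] balanced_joinI[of _ m] by blast

lemma disjoint_graphs_complement: "disjoint_graphs (complement G) (complement H)"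
  by (intro disjoint_graphs.intro)
     (simp_all add: simple_graph_complement simple_G simple_H disjoint)

lemma complement_union: "complement (graph_union G H) = graph_join (complement G) (complement H)"
proof -
  have "(e \<subseteq> verts G \<union> verts H \<and> card e = 2 \<and> e \<notin> edges G \<union> edges H) \<longleftrightarrow>
    (e \<subseteq> verts G \<and> card e = 2 \<and> e \<notin> edges G) \<or> (e \<subseteq> verts H \<and> card e = 2 \<and> e \<notin> edges H) \<or>
    (\<exists>u v. e = {u, v} \<and> u \<in> verts G \<and> v \<in> verts H)" for e
  proof (cases "card e = 2")
    case True
    then obtain u v where e: "e = {u, v}" "u \<noteq> v" by (auto simp: card_2_iff)
    have *: "w \<in> verts H \<Longrightarrow> w \<notin> verts G" for w using disjoint by auto
    show ?thesis unfolding e(1) using e(2) * edge_G edge_H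
      by (auto simp: doubleton_eq_iff)
  next
    case False
    \<comment> \<open>A pair across the two parts has two distinct elements, so it cannot occur in
      this case.\<close>
    have "u \<noteq> v" if "u \<in> verts G" "v \<in> verts H" for u v using that disjoint by auto
    then show ?thesis using False by (auto simp del: card_2_iff)
  qed
  then show ?thesis by (auto simp: complement_def graph_join_def graph_union_def)
qed

lemma complement_join: "complement (graph_join G H) = graph_union (complement G) (complement H)"
proof -
  have "(e \<subseteq> verts G \<union> verts H \<and> card e = 2 \<and> e \<notin> edges (graph_join G H)) \<longleftrightarrow>
    (e \<subseteq> verts G \<and> card e = 2 \<and> e \<notin> edges G) \<or> (e \<subseteq> verts H \<and> card e = 2 \<and> e \<notin> edges H)" for e
  proof (cases "card e = 2")
    case True
    then obtain u v where e: "e = {u, v}" "u \<noteq> v" by (auto simp: card_2_iff)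
    have *: "w \<in> verts H \<Longrightarrow> w \<notin> verts G" for w using disjoint by auto
    show ?thesis unfolding e(1) graph_join_def using e(2) * edge_G edge_H
      by (auto simp: doubleton_eq_iff)
  qed auto
  then show ?thesis by (auto simp: complement_def graph_union_def graph_join_def)
qed

end

section \<open>Induction over cographs\<close>

lemma cograph_verts_nonempty: "cograph G \<Longrightarrow> verts G \<noteq> {}"
  by (induction rule: cograph.induct) auto

lemma complement_single: "complement \<lparr>verts = {v}, edges = {}\<rparr> = \<lparr>verts = {v}, edges = {}\<rparr>"
  by (auto simp: complement_def subset_singleton_iff)

lemma balanced_single: "balanced \<lparr>verts = {v}, edges = {}\<rparr> x m \<Longrightarrow> x = 1 \<and> m = 1"
proof -
  let ?G = "\<lparr>verts = {v}, edges = {}\<rparr> :: 'a graph"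
  assume bal: "balanced ?G x m"
  have G: "simple_graph ?G" by (simp add: simple_graph_def)
  have "x * m = 1" using balanced_card_verts[OF G bal] by simp
  then show ?thesis by simp
qed

text \<open>The parameters stay arbitrary in the induction because the parts of a graph are balanced
  with smaller ones. Tracking both is what makes the induction work: one is shared by the parts and
  the other is split, and complementation swaps these roles.\<close>

lemma balanced_complement:
  assumes "cograph G"
  shows "balanced G x m \<longleftrightarrow> balanced (complement G) m x"
  using assms
proof (induction arbitrary: x m rule: cograph.induct)
  case (single v)
  show ?case
    \<comment> \<open>Either side forces \<open>x = m = 1\<close>, so the swap changes
      nothing.\<close>
    unfolding complement_single using balanced_single[of v x m] balanced_single[of v m x] by auto
next
  case (union G H)
  have A: "disjoint_graphs G H"
    by (intro disjoint_graphs.intro cograph_simple_graph union.hyps)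
  note B = disjoint_graphs.disjoint_graphs_complement[OF A]
  have ne: "verts G \<noteq> {}" "verts H \<noteq> {}"
    using union.hyps cograph_verts_nonempty by blast+
  have "balanced (graph_union G H) x m \<longleftrightarrow> (\<exists>p q. p + q = m \<and> balanced G x p \<and> balanced H x q)"
    by (rule disjoint_graphs.balanced_union_iff) (fact A ne)+
  also have "\<dots> \<longleftrightarrow> (\<exists>p q. p + q = m \<and> balanced (complement G) p x \<and> balanced (complement H) q x)"
    by (simp only: union.IH)
  also have "\<dots> \<longleftrightarrow> balanced (graph_join (complement G) (complement H)) m x"
    using ne by (intro disjoint_graphs.balanced_join_iff[symmetric] B) simp_all
  finally show ?case by (simp only: disjoint_graphs.complement_union[OF A])
next
  case (join G H)
  have A: "disjoint_graphs G H"
    by (intro disjoint_graphs.intro cograph_simple_graph join.hyps)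
  note B = disjoint_graphs.disjoint_graphs_complement[OF A]
  have ne: "verts G \<noteq> {}" "verts H \<noteq> {}"
    using join.hyps cograph_verts_nonempty by blast+
  have "balanced (graph_join G H) x m \<longleftrightarrow> (\<exists>p q. p + q = x \<and> balanced G p m \<and> balanced H q m)"
    by (rule disjoint_graphs.balanced_join_iff) (fact A ne)+
  also have "\<dots> \<longleftrightarrow> (\<exists>p q. p + q = x \<and> balanced (complement G) m p \<and> balanced (complement H) m q)"
    by (simp only: join.IH)
  also have "\<dots> \<longleftrightarrow> balanced (graph_union (complement G) (complement H)) m x"
    using ne by (intro disjoint_graphs.balanced_union_iff[symmetric] B) simp_all
  finally show ?case by (simp only: disjoint_graphs.complement_join[OF A])
qed

theorem theorem9:
  fixes G :: "'a graph"
  assumes "cograph G"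
  shows "well_equi_hued G \<longleftrightarrow> well_equi_hued (complement G)"
proof -
  have G: "simple_graph G" and ne: "verts G \<noteq> {}"
    using assms cograph_simple_graph cograph_verts_nonempty by auto
  have "well_equi_hued G \<longleftrightarrow> (\<exists>x m. balanced G x m)"
    using well_equi_hued_iff_balanced[OF G ne] by (auto simp: balanced_def)
  \<comment> \<open>With both parameters quantified, their exchange is just a renaming.\<close>
  also have "\<dots> \<longleftrightarrow> (\<exists>x m. balanced (complement G) x m)"
    using balanced_complement[OF assms] by blast
  also have "\<dots> \<longleftrightarrow> well_equi_hued (complement G)"
    using well_equi_hued_iff_balanced[OF simple_graph_complement[OF G]] ne
    by (auto simp: balanced_def)
  finally show ?thesis .
qed

end
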